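(* Let $(\overline{\widehat{K}}(X)|K,v)$ be an extension of valued fields, where $\widehat{K}$ is the completion of $(K,v)$. Assume that either $(K(X)|K,v)$ is valuation transcendental such that $vK$ is cofinal in $vK(X)$, or that $(K(X)|K,v)$ is valuation algebraic of type I. Take $\alpha\in v\widehat{K}(X)$ and polynomials $f,g\in\widehat{K}[X]$ with $g\ne 0$. Then there exist polynomials $f',g'\in K[X]$ such that $$\deg f=\deg f',\quad \deg g=\deg g',\quad vf=vf',\quad vg=vg',$$ $$v(f-f')>\alpha,\quad v(g-g')>\alpha,\quad v\Big(\frac{f}{g}-\frac{f'}{g'}\Big)>\alpha.$$
   Context: Valuations are Krull valuations written additively; $vL$, $Lv$ denote value group and residue field. $(K,v)$ is dense in $(L,v)$ if for every $a\in L$, $\gamma\in vL$ there is $b\in K$ with $v(a-b)>\gamma$; the completion $(\widehat{K},v)$ is the maximal extension in which $(K,v)$ is dense. "An extension of valued fields $(\overline{\widehat{K}}(X)|K,v)$" means a valuation $v$ on $\overline{\widehat{K}}(X)$ ($\overline{\widehat{K}}$ the algebraic closure of $\widehat{K}$, containing $\overline{K}$) whose restriction to $\widehat{K}$ is the valuation of the completion; all subfields carry the restricted valuation. $(K(X)|K,v)$ is value transcendental if $\dim_{\mathbb{Q}}\big((vK(X)/vK)\otimes\mathbb{Q}\big)=1$, residue transcendental if $\mathrm{trdeg}[K(X)v:Kv]=1$, valuation transcendental if it is one of these, and valuation algebraic otherwise. A sequence $\{z_\nu\}_{\nu<\lambda}$ ($\lambda$ a limit ordinal) in a valued field is a pseudo-Cauchy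 sequence (pCs) if $v(z_{\nu_1}-z_{\nu_2})<v(z_{\nu_2}-z_{\nu_3})$ for all $\nu_1<\nu_2<\nu_3<\lambda$. A pCs in $(F,v)$ is of transcendental type in $(F,v)$ if for every polynomial $h$ over $F$ the sequence $\{vh(z_\nu)\}_{\nu<\lambda}$ is ultimately constant, and of algebraic type otherwise. Suppose $(K(X)|K,v)$ is valuation algebraic. Then $\{v(X-c)\mid c\in\overline{K}\}$ has no maximum; take a strictly increasing cofinal sequence $\{\gamma_\nu\}_{\nu<\lambda}$ in it ($\lambda$ a limit ordinal) and $a_\nu\in\overline{K}$ with $v(X-a_\nu)=\gamma_\nu$. Then $\{a_\nu\}_{\nu<\lambda}$ is a pCs. $(K(X)|K,v)$ is valuation algebraic of type I if $\{a_\nu\}_{\nu<\lambda}$ is of transcendental type in $(\overline{\widehat{K}},v)$, and of type II otherwise (independent of the choices). *)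

theory Defs
  imports
    "HOL-Library.Extended"
    "HOL-Library.Poly_Mapping"
    "HOL-Algebra.Generated_Fields"
    "HOL-Algebra.Algebraic_Closure_Type"
begin

text \<open>
  The field $\overline{\widehat K}$ is a type \<open>'a\<close> of class \<open>alg_closed_field\<close>, and
  $\overline{\widehat K}(X)$ is \<open>'a poly fract\<close>.  The fields $K$ and $\widehat K$ are subsets of \<open>'a\<close>.
\<close>

section \<open>Subfields of a rational function field\<close>

abbreviation is_subfield :: "'b::field set \<Rightarrow> bool" where
  "is_subfield F \<equiv> subfield F ring_of_type_algebra"

definition polys_over :: "'b::zero set \<Rightarrow> 'b poly set" where
  "polys_over F = {p. set (coeffs p) \<subseteq> F}"

definition alg_over :: "'b::field set \<Rightarrow> 'b \<Rightarrow> bool" where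
  "alg_over F x \<longleftrightarrow> (\<exists>p\<in>polys_over F. p \<noteq> 0 \<and> poly p x = 0)"

definition poly_fract :: "'a::field poly \<Rightarrow> 'a poly fract" where
  "poly_fract p = Fract p 1"

definition const_fract :: "'a::field \<Rightarrow> 'a poly fract" where
  "const_fract c = poly_fract [:c:]"

definition X_fract :: "'a::field poly fract" where
  "X_fract = poly_fract [:0, 1:]"

definition rat_funs :: "'a::field set \<Rightarrow> 'a poly fract set" where
  "rat_funs F = {poly_fract p / poly_fract q | p q. p \<in> polys_over F \<and> q \<in> polys_over F \<and> q \<noteq> 0}"

section \<open>Krull valuations\<close>

text \<open>
  The values lie in the totally ordered abelian group \<open>'g\<close>, enlarged by \<open>Pinf\<close>.  The type
  \<open>'g extended\<close> has an additional least element \<open>Minf\<close>, which is never a value.  A valuation need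
  not be surjective, so its value group is a subgroup of \<open>'g\<close>.
\<close>

definition valuation_on :: "'b::field set \<Rightarrow> ('b \<Rightarrow> 'g::linordered_ab_group_add extended) \<Rightarrow> bool" where
  "valuation_on F v \<longleftrightarrow>
     (\<forall>x\<in>F. v x \<noteq> Minf \<and> (v x = Pinf \<longleftrightarrow> x = 0)) \<and>
     (\<forall>x\<in>F. \<forall>y\<in>F. v (x * y) = v x + v y) \<and>
     (\<forall>x\<in>F. \<forall>y\<in>F. min (v x) (v y) \<le> v (x + y))"

definition value_group :: "'b::field set \<Rightarrow> ('b \<Rightarrow> 'g extended) \<Rightarrow> 'g set" where
  "value_group F v = {\<gamma>. \<exists>x\<in>F. x \<noteq> 0 \<and> v x = Fin \<gamma>}"

definition cofinal_in :: "'g::linorder set \<Rightarrow> 'g set \<Rightarrow> bool" where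
  "cofinal_in A B \<longleftrightarrow> A \<subseteq> B \<and> (\<forall>\<beta>\<in>B. \<exists>\<alpha>\<in>A. \<beta> \<le> \<alpha>)"

definition dense_in ::
    "'b::field set \<Rightarrow> 'b set \<Rightarrow> ('b \<Rightarrow> 'g::linordered_ab_group_add extended) \<Rightarrow> bool" where
  "dense_in F E v \<longleftrightarrow> F \<subseteq> E \<and> (\<forall>a\<in>E. \<forall>\<gamma>\<in>value_group E v. \<exists>b\<in>F. v (a - b) > Fin \<gamma>)"

text \<open>
  The completion is a maximal extension in which $(K,v)$ is dense.  It is enough to let the competing
  extensions $(M,w)$ range over subfields of \<open>'a poly fract\<close> with an arbitrary valuation:
  if $H$ is a proper subfield of $M$, choose $t \in M \setminus H$.  The field $H(t)$ is isomorphic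
  over $H$ to a subfield of \<open>'a\<close> (if $t$ is algebraic over $H$) or to $H(X)$, and $K$ is
  still dense in it.  Density of $K$ also forces $wM = vK$, so no larger group of values is needed.
\<close>

definition is_completion ::
    "'a::alg_closed_field set \<Rightarrow> 'a set \<Rightarrow> ('a poly fract \<Rightarrow> 'g::linordered_ab_group_add extended) \<Rightarrow> bool" where
  "is_completion K H v \<longleftrightarrow>
     is_subfield H \<and> valuation_on (const_fract ` H) v \<and>
     dense_in (const_fract ` K) (const_fract ` H) v \<and>
     (\<forall>M (w :: 'a poly fract \<Rightarrow> 'g extended).
        is_subfield M \<and> const_fract ` H \<subseteq> M \<and> valuation_on M w \<and>
        (\<forall>x\<in>const_fract ` H. w x = v x) \<and> dense_in (const_fract ` K) M w \<longrightarrow>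
        M = const_fract ` H)"

section \<open>Residue fields and transcendence degree\<close>

definition valuation_ring :: "('b::field \<Rightarrow> 'g::linordered_ab_group_add extended) \<Rightarrow> 'b ring" where
  "valuation_ring v = ring_of_type_algebra\<lparr>carrier := {x. 0 \<le> v x}\<rparr>"

definition residue_ring_of :: "('b::field \<Rightarrow> 'g::linordered_ab_group_add extended) \<Rightarrow> 'b set ring" where
  "residue_ring_of v = valuation_ring v Quot {x. 0 < v x}"

text \<open>
  The residue field $Fv$ of a subfield $F$ of the valued field \<open>'b\<close> is taken as a subfield of the residue field
  of \<open>'b\<close>, so that the inclusions $Fv \subseteq Ev$ for $F \subseteq E$ are literal.
\<close>

definition residue_field :: "'b::field set \<Rightarrow> ('b \<Rightarrow> 'g::linordered_ab_group_add extended) \<Rightarrow> 'b set set" where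
  "residue_field F v = (\<lambda>x. {x. 0 < v x} +>\<^bsub>valuation_ring v\<^esub> x) ` {x\<in>F. 0 \<le> v x}"

text \<open>
  In the field $R$, the extension $E|F$ has a transcendence basis with $n$ elements.  Algebraic independence
  of $B$ over $F$ is expressed by each $b \in B$ being transcendental over $F(B \setminus \{b\})$.
\<close>

definition has_trdeg :: "('c, 'd) ring_scheme \<Rightarrow> 'c set \<Rightarrow> 'c set \<Rightarrow> nat \<Rightarrow> bool" where
  "has_trdeg R E F n \<longleftrightarrow>
     (\<exists>B\<subseteq>E. finite B \<and> card B = n \<and>
        (\<forall>b\<in>B. ring.transcendental R (generate_field R (F \<union> (B - {b}))) b) \<and>
        (\<forall>x\<in>E. ring.algebraic R (generate_field R (F \<union> B)) x))"

section \<open>Rational rank of an abelian group\<close>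

definition rat_scale :: "rat \<Rightarrow> ('c \<Rightarrow>\<^sub>0 rat) \<Rightarrow> ('c \<Rightarrow>\<^sub>0 rat)" where
  "rat_scale q p = Poly_Mapping.map ((*) q) p"

lemma lookup_rat_scale [simp]: "Poly_Mapping.lookup (rat_scale q p) x = q * Poly_Mapping.lookup p x"
  by (simp add: rat_scale_def Poly_Mapping.map.rep_eq when_def)

global_interpretation rat_vs: vector_space rat_scale
  by unfold_locales (auto intro!: poly_mapping_eqI simp: lookup_add algebra_simps)

text \<open>
  For an abelian group $A$ (written multiplicatively as an HOL-Algebra record), $A \otimes \mathbb{Q}$ is the
  rational vector space presented by the generators $a \otimes 1$ for $a \in A$, which are the
  \<open>Poly_Mapping.single a 1\<close>, and the relations $(a + b) \otimes 1 = a \otimes 1 + b \otimes 1$.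
\<close>

definition tensor_rat_gens :: "('c, 'd) monoid_scheme \<Rightarrow> ('c \<Rightarrow>\<^sub>0 rat) set" where
  "tensor_rat_gens A = rat_vs.span ((\<lambda>a. Poly_Mapping.single a 1) ` carrier A)"

definition tensor_rat_rels :: "('c, 'd) monoid_scheme \<Rightarrow> ('c \<Rightarrow>\<^sub>0 rat) set" where
  "tensor_rat_rels A = rat_vs.span
     {Poly_Mapping.single (a \<otimes>\<^bsub>A\<^esub> b) 1 - Poly_Mapping.single a 1 - Poly_Mapping.single b 1
      | a b. a \<in> carrier A \<and> b \<in> carrier A}"

definition has_quotient_dim :: "('c \<Rightarrow>\<^sub>0 rat) set \<Rightarrow> ('c \<Rightarrow>\<^sub>0 rat) set \<Rightarrow> nat \<Rightarrow> bool" where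
  "has_quotient_dim V R n \<longleftrightarrow>
     (\<exists>B\<subseteq>V. finite B \<and> card B = n \<and>
        (\<forall>x\<in>V. \<exists>!c. (\<forall>b. b \<notin> B \<longrightarrow> c b = 0) \<and> x - (\<Sum>b\<in>B. rat_scale (c b) b) \<in> R))"

definition has_rational_rank :: "('c, 'd) monoid_scheme \<Rightarrow> nat \<Rightarrow> bool" where
  "has_rational_rank A n \<longleftrightarrow> has_quotient_dim (tensor_rat_gens A) (tensor_rat_rels A) n"

definition add_group_on :: "'g::ab_group_add set \<Rightarrow> 'g monoid" where
  "add_group_on G = \<lparr>carrier = G, monoid.mult = (+), one = 0\<rparr>"

section \<open>Valuation transcendental and valuation algebraic extensions\<close>

definition value_transcendental ::
    "'a::alg_closed_field set \<Rightarrow> ('a poly fract \<Rightarrow> 'g::linordered_ab_group_add extended) \<Rightarrow> bool" where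
  "value_transcendental K v \<longleftrightarrow>
     has_rational_rank
       (add_group_on (value_group (rat_funs K) v) Mod value_group (const_fract ` K) v) 1"

definition residue_transcendental ::
    "'a::alg_closed_field set \<Rightarrow> ('a poly fract \<Rightarrow> 'g::linordered_ab_group_add extended) \<Rightarrow> bool" where
  "residue_transcendental K v \<longleftrightarrow>
     has_trdeg (residue_ring_of v) (residue_field (rat_funs K) v) (residue_field (const_fract ` K) v) 1"

definition valuation_transcendental ::
    "'a::alg_closed_field set \<Rightarrow> ('a poly fract \<Rightarrow> 'g::linordered_ab_group_add extended) \<Rightarrow> bool" where
  "valuation_transcendental K v \<longleftrightarrow> value_transcendental K v \<or> residue_transcendental K v"

definition valuation_algebraic ::
    "'a::alg_closed_field set \<Rightarrow> ('a poly fract \<Rightarrow> 'g::linordered_ab_group_add extended) \<Rightarrow> bool" where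
  "valuation_algebraic K v \<longleftrightarrow> \<not> valuation_transcendental K v"

section \<open>Pseudo-Cauchy sequences\<close>

text \<open>A limit ordinal $\lambda$ is represented by a non-empty well-order without a last element.\<close>

definition limit_well_order :: "'i rel \<Rightarrow> bool" where
  "limit_well_order r \<longleftrightarrow>
     Well_order r \<and> Field r \<noteq> {} \<and> (\<forall>i\<in>Field r. \<exists>j. (i, j) \<in> r \<and> i \<noteq> j)"

definition pseudo_Cauchy ::
    "'i rel \<Rightarrow> ('b::field \<Rightarrow> 'g::linordered_ab_group_add extended) \<Rightarrow> ('i \<Rightarrow> 'b) \<Rightarrow> bool" where
  "pseudo_Cauchy r v z \<longleftrightarrow>
     limit_well_order r \<and>
     (\<forall>i j k. (i, j) \<in> r \<and> i \<noteq> j \<and> (j, k) \<in> r \<and> j \<noteq> k \<longrightarrow> v (z i - z j) < v (z j - z k))"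

definition transcendental_type ::
    "'i rel \<Rightarrow> 'b::field set \<Rightarrow> ('b \<Rightarrow> 'g::linordered_ab_group_add extended) \<Rightarrow> ('i \<Rightarrow> 'b) \<Rightarrow> bool" where
  "transcendental_type r F v z \<longleftrightarrow>
     pseudo_Cauchy r v z \<and> z ` Field r \<subseteq> F \<and>
     (\<forall>h\<in>polys_over F. \<exists>i\<in>Field r. \<forall>j. (i, j) \<in> r \<longrightarrow> v (poly h (z j)) = v (poly h (z i)))"

text \<open>
  The index set may be taken inside \<open>'g\<close>, since \<open>\<gamma>\<close> is strictly increasing
  with finite values.  The sequence is quantified existentially; such sequences exist for every
  valuation algebraic extension, and the type does not depend on their choice.
\<close>

definition valuation_algebraic_type_I ::
    "'a::alg_closed_field set \<Rightarrow> ('a poly fract \<Rightarrow> 'g::linordered_ab_group_add extended) \<Rightarrow> bool" where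
  "valuation_algebraic_type_I K v \<longleftrightarrow>
     valuation_algebraic K v \<and>
     (\<exists>(r :: 'g rel) \<gamma> a.
        limit_well_order r \<and>
        (\<forall>i j. (i, j) \<in> r \<and> i \<noteq> j \<longrightarrow> \<gamma> i < \<gamma> j) \<and>
        cofinal_in (\<gamma> ` Field r) {v (X_fract - const_fract c) | c. alg_over K c} \<and>
        (\<forall>i\<in>Field r. alg_over K (a i) \<and> v (X_fract - const_fract (a i)) = \<gamma> i) \<and>
        transcendental_type r (range const_fract) v (\<lambda>i. const_fract (a i)))"

end

theory Submission
  imports Defs
begin

text \<open>
  Call a value bounded if it lies between two elements of $vK$.  It suffices that $v(X-b)$ is bounded
  for all $b \in \overline{\widehat K}$: then, factoring polynomials over $\overline{\widehat K}$,
  all values on $\widehat K(X)$ are bounded, and approximating the coefficients of $f$ and $g$ closely enough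
  by elements of $K$ gives all the claims.

  For type I, apply the transcendental type of $(a_\nu)$ to the linear polynomial $X - b$: if
  $v(X-b) > \gamma_\nu$ for all $\nu$, then $v(a_\nu - b) = \gamma_\nu$ would not be ultimately constant.  So
  $v(X-b) = v(a_\nu-b)$ for large $\nu$, which is a value of an algebraic element.

  Suppose now that $vK$ is cofinal in $vK(X)$ but $v(X-b)$ is not bounded, so that it exceeds $vK$.
  Then so does $v(f(X)-f(b))$ for every polynomial $f$, while $vf$ is bounded for $0 \ne f \in K[X]$.  Hence
  every element of $K(X)$ has the same value and the same residue as an element of $\overline{\widehat K}$, which is
  algebraic over $\widehat K$, and $\widehat K$ has the same value group and residue field as $K$.  So $K(X)|K$ is not
  valuation transcendental.
\<close>

section \<open>Polynomials and rational functions over a subfield\<close>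

text \<open>\<open>coeffs\<close> stops at the leading coefficient, and all later coefficients are
  0; this is where 0 must lie in \<open>F\<close>.\<close>

lemma mem_polys_over_iff:
  assumes "0 \<in> F"
  shows "p \<in> polys_over F \<longleftrightarrow> (\<forall>i. coeff p i \<in> F)"
proof -
  have "p \<in> polys_over F \<longleftrightarrow> range (coeff p) \<subseteq> F"
    using assms by (simp add: polys_over_def range_coeff)
  then show ?thesis by auto
qed

text \<open>Carries the closure rules of HOL-Algebra over to the type class operations. The
  conventions \<open>inverse 0 = 0\<close> and \<open>x / 0 = 0\<close> allow the rules for
  \<open>inverse\<close> and division to be stated without side conditions.\<close>

lemma subfield_simps:
  fixes F :: "'b::field set"
  assumes "is_subfield F"
  shows "0 \<in> F" and "1 \<in> F"
    and "x \<in> F \<Longrightarrow> y \<in> F \<Longrightarrow> x + y \<in> F"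
    and "x \<in> F \<Longrightarrow> y \<in> F \<Longrightarrow> x * y \<in> F"
    and "x \<in> F \<Longrightarrow> inverse x \<in> F"
    and "x \<in> F \<Longrightarrow> y \<in> F \<Longrightarrow> x / y \<in> F"
proof -
  interpret R: field "ring_of_type_algebra :: 'b ring" by (rule field_from_type_algebra)
  interpret S: subfield F "ring_of_type_algebra :: 'b ring" by fact
  show zero: "0 \<in> F" and "1 \<in> F"
    and "x \<in> F \<Longrightarrow> y \<in> F \<Longrightarrow> x + y \<in> F"
    and mult: "x \<in> F \<Longrightarrow> y \<in> F \<Longrightarrow> x * y \<in> F" for x y
    using R.subfield_m_inv subringE[OF S.subring_axioms]
    by (auto simp: ring_of_type_algebra_def)
  show inv: "x \<in> F \<Longrightarrow> inverse x \<in> F" for x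
  proof (cases "x = 0")
    case False
    assume "x \<in> F"
    with False have "x \<in> F - {\<zero>\<^bsub>ring_of_type_algebra\<^esub>}"
      by (simp add: ring_of_type_algebra_def)
    from R.subfield_m_inv[OF S.subfield_axioms this] have
      "inv\<^bsub>ring_of_type_algebra\<^esub> x \<in> F" "x * inv\<^bsub>ring_of_type_algebra\<^esub> x = 1"
      by (auto simp: ring_of_type_algebra_def)
    then show ?thesis by (metis inverse_unique)
  qed (use zero in simp)
  show "x \<in> F \<Longrightarrow> y \<in> F \<Longrightarrow> x / y \<in> F"
    using mult inv by (simp add: divide_inverse)
qed

lemma poly_fract_0 [simp]: "poly_fract 0 = 0"
  and poly_fract_1 [simp]: "poly_fract 1 = 1"
  and poly_fract_add: "poly_fract (p + q) = poly_fract p + poly_fract q"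
  and poly_fract_diff: "poly_fract (p - q) = poly_fract p - poly_fract q"
  and poly_fract_mult: "poly_fract (p * q) = poly_fract p * poly_fract q"
  and poly_fract_eq_iff [simp]: "poly_fract p = poly_fract q \<longleftrightarrow> p = q"
  by (simp_all add: poly_fract_def Zero_fract_def One_fract_def eq_fract)

lemma poly_fract_eq_0_iff [simp]: "poly_fract p = 0 \<longleftrightarrow> p = 0"
  using poly_fract_eq_iff[of p 0] by (simp del: poly_fract_eq_iff)

lemma const_fract_0 [simp]: "const_fract 0 = 0"
  and const_fract_1 [simp]: "const_fract 1 = 1"
  and const_fract_eq_iff [simp]: "const_fract a = const_fract b \<longleftrightarrow> a = b"
  and const_fract_eq_0_iff [simp]: "const_fract a = 0 \<longleftrightarrow> a = 0"
  by (simp_all add: const_fract_def flip: one_pCons)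

lemma const_fract_add: "const_fract (a + b) = const_fract a + const_fract b"
  and const_fract_diff: "const_fract (a - b) = const_fract a - const_fract b"
  and const_fract_mult: "const_fract (a * b) = const_fract a * const_fract b"
  by (simp_all add: const_fract_def flip: poly_fract_add poly_fract_diff poly_fract_mult)

lemma const_fract_divide: "const_fract (a / b) = const_fract a / const_fract b"
proof (cases "b = 0")
  case False
  then have "const_fract (a / b) * const_fract b = const_fract a"
    by (simp flip: const_fract_mult)
  with False show ?thesis by (simp add: field_simps)
qed simp

lemma const_fract_inverse: "const_fract (inverse a) = inverse (const_fract a)"
  using const_fract_divide[of 1 a] by (simp add: inverse_eq_divide)

lemma const_fract_power: "const_fract (a ^ n) = const_fract a ^ n"
  by (induction n) (simp_all add: const_fract_mult)

lemma const_fract_sum: "const_fract (sum f I) = (\<Sum>i\<in>I. const_fract (f i))"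
  by (induction I rule: infinite_finite_induct) (simp_all add: const_fract_add)

lemma poly_fract_pCons: "poly_fract (pCons a p) = const_fract a + X_fract * poly_fract p"
  by (simp add: const_fract_def X_fract_def flip: poly_fract_add poly_fract_mult)

lemma X_fract_minus_const: "X_fract - const_fract b = poly_fract [:- b, 1:]"
  by (simp add: const_fract_def X_fract_def flip: poly_fract_diff)

lemma X_fract_neq_const [simp]: "X_fract \<noteq> const_fract b"
  by (simp add: X_fract_def const_fract_def)

lemma X_fract_neq_0 [simp]: "X_fract \<noteq> 0"
  using X_fract_neq_const[of 0] by (simp del: X_fract_neq_const)

lemma poly_fract_in_rat_funs: "is_subfield F \<Longrightarrow> p \<in> polys_over F \<Longrightarrow> poly_fract p \<in> rat_funs F"
  unfolding rat_funs_def
  by (intro CollectI exI[of _ p] exI[of _ 1]) (simp add: mem_polys_over_iff subfield_simps)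

lemma rat_funs_divide:
  assumes F: "is_subfield F" and "x \<in> rat_funs F" "y \<in> rat_funs F"
  shows "x / y \<in> rat_funs F"
proof -
  note S = subfield_simps[OF F]
  obtain p q r s where *: "p \<in> polys_over F" "q \<in> polys_over F" "r \<in> polys_over F" "s \<in> polys_over F"
    "q \<noteq> 0" "s \<noteq> 0" "x = poly_fract p / poly_fract q" "y = poly_fract r / poly_fract s"
    using assms by (auto simp: rat_funs_def)
  have prod: "a * b \<in> polys_over F" if "a \<in> polys_over F" "b \<in> polys_over F" for a b
  proof -
    have "(\<Sum>i\<in>I. coeff a i * coeff b (n - i)) \<in> F" for I n
      using that S by (induction I rule: infinite_finite_induct) (auto simp: mem_polys_over_iff)
    with S show ?thesis by (simp add: mem_polys_over_iff coeff_mult)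
  qed
  \<comment> \<open>For \<open>r = 0\<close> the quotient is a division by 0, hence 0 by convention,
    and \<open>q * r\<close> is not an admissible denominator.\<close>
  show ?thesis
  proof (cases "r = 0")
    case True
    then have "x / y = poly_fract 0" using *(8) by simp
    with poly_fract_in_rat_funs[OF F, of 0] show ?thesis using S(1) by (simp only: mem_polys_over_iff coeff_0) simp
  next
    case False
    with * have "x / y = poly_fract (p * s) / poly_fract (q * r)"
      by (simp add: poly_fract_mult)
    with False * prod show ?thesis unfolding rat_funs_def
      by (intro CollectI exI[of _ "p * s"] exI[of _ "q * r"]) simp
  qed
qed

lemma rat_funs_1: "is_subfield F \<Longrightarrow> 1 \<in> rat_funs F"
  using poly_fract_in_rat_funs[of F 1] by (simp add: mem_polys_over_iff subfield_simps)

lemma const_fract_in_rat_funs: "is_subfield F \<Longrightarrow> a \<in> F \<Longrightarrow> const_fract a \<in> rat_funs F"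
  unfolding const_fract_def
  by (auto intro!: poly_fract_in_rat_funs simp: mem_polys_over_iff subfield_simps coeff_pCons split: nat.splits)

lemma X_fract_in_rat_funs: "is_subfield F \<Longrightarrow> X_fract \<in> rat_funs F"
  unfolding X_fract_def
  by (auto intro!: poly_fract_in_rat_funs simp: mem_polys_over_iff subfield_simps coeff_pCons split: nat.splits)

lemma poly_Poly_map_upt: "poly (Poly (map f [0..<n])) x = (\<Sum>i<n. f i * x ^ i)"
  for x :: "'c::comm_ring_1"
  by (induction n) (simp_all add: Poly_append poly_monom algebra_simps)

section \<open>Torsion groups\<close>

text \<open>Each factor \<open>a\<close> contributes one defining relation of the tensor product, so
  that a power becomes a multiple modulo the relations.\<close>

lemma single_pow_mod_tensor_rat_rels:
  assumes "monoid A" and "a \<in> carrier A"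
  shows "Poly_Mapping.single (a [^]\<^bsub>A\<^esub> n) 1 - rat_scale (of_nat n) (Poly_Mapping.single a 1)
    \<in> tensor_rat_rels A"
proof -
  interpret monoid A by fact
  have rel: "Poly_Mapping.single (x \<otimes>\<^bsub>A\<^esub> y) 1 - Poly_Mapping.single x 1 - Poly_Mapping.single y 1
      \<in> tensor_rat_rels A" if "x \<in> carrier A" "y \<in> carrier A" for x y
    using that by (auto simp: tensor_rat_rels_def intro!: rat_vs.span_base)
  show ?thesis
  proof (induction n)
    case 0
    \<comment> \<open>The relation for the pair of identities collapses to minus the generator of
      the identity, so that generator is itself a relation.\<close>
    have "- (Poly_Mapping.single (\<one>\<^bsub>A\<^esub> \<otimes>\<^bsub>A\<^esub> \<one>\<^bsub>A\<^esub>) 1 - Poly_Mapping.single \<one>\<^bsub>A\<^esub> 1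
        - Poly_Mapping.single \<one>\<^bsub>A\<^esub> (1::rat)) \<in> tensor_rat_rels A"
      unfolding tensor_rat_rels_def
      by (intro rat_vs.span_neg rel[unfolded tensor_rat_rels_def]) auto
    then show ?case by simp
  next
    case (Suc n)
    from rel[of "a [^]\<^bsub>A\<^esub> n" a] Suc assms(2) have
      "(Poly_Mapping.single (a [^]\<^bsub>A\<^esub> n \<otimes>\<^bsub>A\<^esub> a) 1 - Poly_Mapping.single (a [^]\<^bsub>A\<^esub> n) 1
          - Poly_Mapping.single a 1) +
       (Poly_Mapping.single (a [^]\<^bsub>A\<^esub> n) 1 - rat_scale (of_nat n) (Poly_Mapping.single a 1))
        \<in> tensor_rat_rels A"
      unfolding tensor_rat_rels_def by (intro rat_vs.span_add) simp_all
    then show ?case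
      by (simp add: rat_vs.scale_left_distrib algebra_simps)
  qed
qed

text \<open>A torsion element dies in the tensor product with the rationals, because its multiple by
  some n > 0 vanishes and n is invertible. All generators then lie in the span of the relations, and
  the coefficient of a single basis vector cannot be unique.\<close>

lemma torsion_imp_not_rational_rank_1:
  assumes "monoid A" and torsion: "\<And>a. a \<in> carrier A \<Longrightarrow> \<exists>n>0. a [^]\<^bsub>A\<^esub> (n::nat) = \<one>\<^bsub>A\<^esub>"
  shows "\<not> has_rational_rank A 1"
proof
  interpret monoid A by fact
  have "Poly_Mapping.single a 1 \<in> tensor_rat_rels A" if a: "a \<in> carrier A" for a
  proof -
    obtain n where n: "n > 0" "a [^]\<^bsub>A\<^esub> (n::nat) = \<one>\<^bsub>A\<^esub>" using torsion[OF a] by blast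
    \<comment> \<open>The generator of the identity equals that of the n-th power of
      \<open>a\<close>, so it cancels and n times the generator of \<open>a\<close> remains.\<close>
    have "(Poly_Mapping.single (\<one>\<^bsub>A\<^esub> [^]\<^bsub>A\<^esub> (0::nat)) 1
        - rat_scale (of_nat 0) (Poly_Mapping.single \<one>\<^bsub>A\<^esub> 1))
      - (Poly_Mapping.single (a [^]\<^bsub>A\<^esub> n) 1 - rat_scale (of_nat n) (Poly_Mapping.single a 1))
      \<in> tensor_rat_rels A"
      using single_pow_mod_tensor_rat_rels[OF assms(1), of "\<one>\<^bsub>A\<^esub>" 0]
        single_pow_mod_tensor_rat_rels[OF assms(1) a, of n]
      unfolding tensor_rat_rels_def by (rule rat_vs.span_diff) simp_all
    then have "rat_scale (of_nat n) (Poly_Mapping.single a 1) \<in> tensor_rat_rels A"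
      by (simp add: n(2))
    then have "rat_scale (inverse (of_nat n)) (rat_scale (of_nat n) (Poly_Mapping.single a 1))
        \<in> tensor_rat_rels A"
      unfolding tensor_rat_rels_def by (rule rat_vs.span_scale)
    with n(1) show ?thesis by simp
  qed
  then have sub: "tensor_rat_gens A \<subseteq> tensor_rat_rels A"
    unfolding tensor_rat_gens_def tensor_rat_rels_def
    by (intro rat_vs.span_minimal) (auto simp: rat_vs.subspace_span)
  assume "has_rational_rank A 1"
  then obtain B where B: "B \<subseteq> tensor_rat_gens A" "card B = 1"
    and ex1: "\<forall>x\<in>tensor_rat_gens A. \<exists>!c. (\<forall>b. b \<notin> B \<longrightarrow> c b = 0) \<and>
      x - (\<Sum>b\<in>B. rat_scale (c b) b) \<in> tensor_rat_rels A"
    unfolding has_rational_rank_def has_quotient_dim_def by (elim exE conjE) (rule that)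
  obtain b where b: "B = {b}" using B(2) by (rule card_1_singletonE)
  \<comment> \<open>\<open>P\<close> is the property that should hold for exactly one coefficient
    function representing \<open>b\<close>. Both the zero function and the indicator of
    \<open>b\<close> satisfy it.\<close>
  define P where "P c \<longleftrightarrow> (\<forall>b'. b' \<notin> B \<longrightarrow> c b' = 0) \<and>
      b - (\<Sum>b\<in>B. rat_scale (c b) b) \<in> tensor_rat_rels A" for c
  have "b \<in> tensor_rat_rels A"
    using b B(1) sub by blast
  then have P0: "P (\<lambda>_. 0)"
    by (simp add: P_def b)
  have "0 \<in> tensor_rat_rels A"
    unfolding tensor_rat_rels_def by (rule rat_vs.span_zero)
  then have P1: "P (\<lambda>b'. if b' = b then 1 else 0)"
    by (simp add: P_def b)
  have "b \<in> tensor_rat_gens A" using b B(1) by blast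
  then have "\<exists>!c. P c" unfolding P_def by (rule ex1[rule_format])
  then have "(\<lambda>_. 0) = (\<lambda>b'. if b' = b then 1 else (0::rat))"
    using P0 P1 by (metis (no_types))
  then have "0 = (if b = b then 1 else (0::rat))" by (rule fun_cong)
  then show False by simp
qed

section \<open>Krull valuations\<close>

locale krull_valuation =
  fixes v :: "'b::field \<Rightarrow> 'g::linordered_ab_group_add extended"
  assumes valuation: "valuation_on UNIV v"
begin

text \<open>The value of $0$ is arbitrary.\<close>

definition val :: "'b \<Rightarrow> 'g" where
  "val x = (THE \<gamma>. v x = Fin \<gamma>)"

lemma v_0 [simp]: "v 0 = Pinf"
  using valuation by (auto simp: valuation_on_def)

lemma v_nonzero: "x \<noteq> 0 \<Longrightarrow> v x = Fin (val x)"
  using valuation by (cases "v x") (auto simp: valuation_on_def val_def)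

lemma v_eq_Fin_iff [simp]: "v x = Fin \<gamma> \<longleftrightarrow> x \<noteq> 0 \<and> val x = \<gamma>"
  by (cases "x = 0") (auto simp: v_nonzero)

lemma v_mult: "v (x * y) = v x + v y"
  using valuation by (auto simp: valuation_on_def)

lemma v_add: "min (v x) (v y) \<le> v (x + y)"
  using valuation by (auto simp: valuation_on_def)

lemma val_mult: "x \<noteq> 0 \<Longrightarrow> y \<noteq> 0 \<Longrightarrow> val (x * y) = val x + val y"
  using v_mult[of x y] by (simp add: v_nonzero)

lemma val_1 [simp]: "val 1 = 0"
  using val_mult[of 1 1] by simp

text \<open>An ordered group has no torsion, so twice the value being 0 leaves only 0.\<close>

lemma val_uminus_1: "val (- 1) = 0"
proof -
  have *: "val (- 1) + val (- 1) = 0"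
    using val_mult[of "- 1" "- 1"] by simp
  show ?thesis
  proof (rule antisym)
    show "val (- 1) \<le> 0"
    proof (rule ccontr)
      assume "\<not> ?thesis"
      then have "0 < val (- 1) + val (- 1)" by (intro add_pos_pos) auto
      with * show False by simp
    qed
    show "0 \<le> val (- 1)"
    proof (rule ccontr)
      assume "\<not> ?thesis"
      then have "val (- 1) + val (- 1) < 0" by (intro add_neg_neg) auto
      with * show False by simp
    qed
  qed
qed

lemma v_minus [simp]: "v (- x) = v x"
proof (cases "x = 0")
  case False
  then show ?thesis using val_mult[of "- 1" x] by (simp add: v_nonzero val_uminus_1)
qed simp

lemma v_minus_commute: "v (x - y) = v (y - x)"
  using v_minus[of "x - y"] by simp

lemma val_divide:
  assumes "x \<noteq> 0" "y \<noteq> 0"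
  shows "val (x / y) = val x - val y"
proof -
  have "val x = val (x / y) + val y"
    using assms val_mult[of "x / y" y] by simp
  then show ?thesis by (simp add: algebra_simps)
qed

lemma val_inverse: "x \<noteq> 0 \<Longrightarrow> val (inverse x) = - val x"
  using val_divide[of 1 x] by (simp add: inverse_eq_divide)

lemma less_v_mult_iff: "y \<noteq> 0 \<Longrightarrow> Fin \<delta> < v (x * y) \<longleftrightarrow> Fin (\<delta> - val y) < v x"
  by (cases "x = 0") (auto simp: v_nonzero val_mult algebra_simps)

lemma less_v_divide_iff: "y \<noteq> 0 \<Longrightarrow> Fin \<delta> < v (x / y) \<longleftrightarrow> Fin (\<delta> + val y) < v x"
  by (cases "x = 0") (auto simp: v_nonzero val_divide algebra_simps)

lemma le_v_mult: "Fin \<gamma> \<le> v x \<Longrightarrow> Fin \<delta> \<le> v y \<Longrightarrow> Fin (\<gamma> + \<delta>) \<le> v (x * y)"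
  by (cases "x = 0"; cases "y = 0") (auto simp: v_nonzero val_mult add_mono)

lemma le_v_add: "Fin \<delta> \<le> v x \<Longrightarrow> Fin \<delta> \<le> v y \<Longrightarrow> Fin \<delta> \<le> v (x + y)"
  using v_add[of x y] by (meson min.boundedI order_trans)

lemma less_v_add: "Fin \<delta> < v x \<Longrightarrow> Fin \<delta> < v y \<Longrightarrow> Fin \<delta> < v (x + y)"
  using v_add[of x y] by (meson less_le_trans min_less_iff_conj)

lemma less_v_diff: "Fin \<delta> < v x \<Longrightarrow> Fin \<delta> < v y \<Longrightarrow> Fin \<delta> < v (x - y)"
  using less_v_add[of \<delta> x "- y"] by simp

lemma less_v_sum: "(\<And>i. i \<in> I \<Longrightarrow> Fin \<delta> < v (t i)) \<Longrightarrow> Fin \<delta> < v (sum t I)"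
  by (induction I rule: infinite_finite_induct) (auto intro: less_v_add)

text \<open>If \<open>y\<close> had a larger value than \<open>x\<close>, then x = (x - y) + y would
  have value above its own. This is how values are transferred to approximations throughout.\<close>

lemma v_eq_of_close:
  assumes "x \<noteq> 0" "Fin (val x) < v (x - y)"
  shows "y \<noteq> 0" "val y = val x"
proof -
  have "v y = v x"
  proof (rule antisym)
    have "v x \<le> v (x - (x - y))"
      using le_v_add[of "val x" x "- (x - y)"] assms by (simp add: v_nonzero v_minus_commute)
    then show "v x \<le> v y" by simp
    show "v y \<le> v x"
    proof (rule ccontr)
      assume "\<not> v y \<le> v x"
      then have "Fin (val x) < v ((x - y) + y)"
        using assms by (intro less_v_add) (auto simp: v_nonzero)
      then show False using assms by (simp add: v_nonzero)
    qed
  qed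
  with assms show "y \<noteq> 0" "val y = val x" by (auto simp: v_nonzero)
qed

lemma v_eq_of_less: "v x < v (x - y) \<Longrightarrow> v y = v x"
  using v_eq_of_close[of x y] by (cases "x = 0") (auto simp: v_nonzero)

text \<open>The term of least value is unique and dominates: all the others together have strictly
  larger value, so they cannot cancel it.\<close>

lemma sum_nonzero_of_distinct_values:
  assumes "finite I" "I \<noteq> {}" "\<And>i. i \<in> I \<Longrightarrow> t i \<noteq> 0" "inj_on (\<lambda>i. val (t i)) I"
  shows "sum t I \<noteq> 0"
proof -
  define m where "m = arg_min_on (\<lambda>i. val (t i)) I"
  have m: "m \<in> I" "\<And>i. i \<in> I \<Longrightarrow> val (t m) \<le> val (t i)"
    using assms arg_min_if_finite(1)[of I "\<lambda>i. val (t i)"] arg_min_least[of I _ "\<lambda>i. val (t i)"]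
    by (auto simp: m_def)
  have "val (t m) < val (t i)" if "i \<in> I - {m}" for i
    using that m assms(4) by (metis DiffE inj_onD insertI1 order_less_le)
  then have "Fin (val (t m)) < v (sum t (I - {m}))"
    using assms(3) by (intro less_v_sum) (auto simp: v_nonzero)
  then have "Fin (val (t m)) < v (t m - sum t I)"
    using assms m by (simp add: sum.remove[of I m])
  with v_eq_of_close(1) assms(3) m show ?thesis by blast
qed

text \<open>The error splits into (f - f')/g' and (g - g') f/(g g'). The second part vanishes for f
  = 0, where \<open>val f\<close> would be meaningless; hence the conditional last
  hypothesis.\<close>

lemma less_v_quotient_diff:
  assumes "g \<noteq> 0" "g' \<noteq> 0" "val g' = val g" "Fin (\<beta> + val g) < v (f - f')"
    and "f \<noteq> 0 \<Longrightarrow> Fin (\<beta> + val g + val g - val f) < v (g - g')"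
  shows "Fin \<beta> < v (f / g - f' / g')"
proof -
  have "f / g - f' / g' = (f - f') / g' - (g - g') * f / (g * g')"
    using assms(1,2) by (simp add: field_simps)
  moreover have "Fin \<beta> < v ((f - f') / g')"
    using assms by (simp add: less_v_divide_iff)
  moreover have "Fin \<beta> < v ((g - g') * f / (g * g'))"
    using assms
    by (cases "f = 0") (auto simp: less_v_divide_iff less_v_mult_iff val_mult add.assoc)
  ultimately show ?thesis by (auto intro: less_v_diff)
qed

section \<open>Value groups and their quotients\<close>

lemma group_add_group_on_value_group:
  assumes "1 \<in> F" "\<And>x y. x \<in> F \<Longrightarrow> y \<in> F \<Longrightarrow> x / y \<in> F"
  shows "group (add_group_on (value_group F v))"
proof -
  have inv: "inverse x \<in> F" if "x \<in> F" for x
    using assms(2)[OF assms(1) that] by (simp add: inverse_eq_divide)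
  have mult: "x * y \<in> F" if "x \<in> F" "y \<in> F" for x y
    using assms(2)[OF that(1) inv[OF that(2)]] by (simp add: divide_inverse)
  have [intro]: "a + b \<in> value_group F v" if "a \<in> value_group F v" "b \<in> value_group F v" for a b
  proof -
    from that obtain x y where "x \<in> F" "y \<in> F" "x \<noteq> 0" "y \<noteq> 0" "a = val x" "b = val y"
      by (auto simp: value_group_def)
    with mult show ?thesis by (auto simp: value_group_def val_mult intro!: bexI[of _ "x * y"])
  qed
  have "- a \<in> value_group F v" if "a \<in> value_group F v" for a
    using that inv by (auto simp: value_group_def v_nonzero val_inverse intro!: bexI[of _ "inverse _"])
  then have "\<exists>b\<in>value_group F v. b + a = 0" if "a \<in> value_group F v" for a
    using that by (intro bexI[of _ "- a"]) auto
  moreover have "0 \<in> value_group F v"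
    using assms(1) by (auto simp: value_group_def intro!: bexI[of _ 1])
  ultimately show ?thesis
    by (intro groupI) (auto simp: add_group_on_def add.assoc)
qed

text \<open>The torsion criterion phrased with field elements: if a positive power of x has the
  value of some element of \<open>F\<close>, then the class of the value of x has finite order in
  vE/vF.\<close>

lemma torsion_imp_not_rational_rank_1_Mod:
  assumes E: "1 \<in> E" "\<And>x y. x \<in> E \<Longrightarrow> y \<in> E \<Longrightarrow> x / y \<in> E"
    and F: "1 \<in> F" "\<And>x y. x \<in> F \<Longrightarrow> y \<in> F \<Longrightarrow> x / y \<in> F" "F \<subseteq> E"
    and torsion: "\<And>x. x \<in> E \<Longrightarrow> x \<noteq> 0 \<Longrightarrow> \<exists>n>0. \<exists>c\<in>F. c \<noteq> 0 \<and> val (x ^ n) = val c"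
  shows "\<not> has_rational_rank (add_group_on (value_group E v) Mod value_group F v) 1"
proof -
  define G where "G = add_group_on (value_group E v)"
  define N where "N = value_group F v"
  interpret G: group G unfolding G_def using E by (rule group_add_group_on_value_group)
  interpret N': group "add_group_on N" unfolding N_def using F(1,2) by (rule group_add_group_on_value_group)
  interpret G: comm_group G
    by (rule G.group_comm_groupI) (simp add: G_def add_group_on_def add.commute)
  have sub: "N \<subseteq> carrier G" using F(3) by (auto simp: N_def G_def add_group_on_def value_group_def)
  have "add_group_on N = G\<lparr>carrier := N\<rparr>" by (simp add: G_def add_group_on_def)
  then have subgroup: "subgroup N G"
    using N'.group_axioms sub by (intro G.group_incl_imp_subgroup) simp_all
  interpret N: normal N G using subgroup by (rule G.subgroup_imp_normal)
  interpret Q: group "G Mod N" by (rule N.factorgroup_is_group)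
  interpret h: group_hom G "G Mod N" "\<lambda>a. N #>\<^bsub>G\<^esub> a"
    by unfold_locales (rule N.r_coset_hom_Mod)
  have pow: "val x [^]\<^bsub>G\<^esub> n = val (x ^ n)" if "x \<noteq> 0" for x and n :: nat
    by (induction n) (use that in \<open>auto simp: G_def add_group_on_def val_mult nat_pow_def add.commute\<close>)
  show ?thesis unfolding G_def[symmetric] N_def[symmetric]
  proof (rule torsion_imp_not_rational_rank_1)
    show "Group.monoid (G Mod N)" by (rule Q.monoid_axioms)
    fix a assume "a \<in> carrier (G Mod N)"
    then obtain \<gamma> where \<gamma>: "\<gamma> \<in> carrier G" "a = N #>\<^bsub>G\<^esub> \<gamma>"
      by (auto simp: FactGroup_def RCOSETS_def)
    then obtain x where x: "x \<in> E" "x \<noteq> 0" "\<gamma> = val x"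
      by (auto simp: G_def add_group_on_def value_group_def)
    with torsion obtain n c where n: "n > 0" "c \<in> F" "c \<noteq> 0" "val (x ^ n) = val c" by metis
    then have "\<gamma> [^]\<^bsub>G\<^esub> n \<in> N" using x pow by (auto simp: N_def value_group_def)
    then have "N #>\<^bsub>G\<^esub> (\<gamma> [^]\<^bsub>G\<^esub> n) = \<one>\<^bsub>G Mod N\<^esub>"
      using G.coset_join2[OF _ subgroup] sub by (auto simp: FactGroup_def)
    then show "\<exists>n>0. a [^]\<^bsub>G Mod N\<^esub> (n::nat) = \<one>\<^bsub>G Mod N\<^esub>"
      using n \<gamma> h.hom_nat_pow by auto
  qed
qed

section \<open>The valuation ring and its residue field\<close>

lemma ring_valuation_ring: "ring (valuation_ring v)"
proof -
  have add: "0 \<le> v x \<Longrightarrow> 0 \<le> v y \<Longrightarrow> 0 \<le> v (x + y)" for x y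
    using le_v_add[of 0] by (simp add: zero_extended_def)
  have mult: "0 \<le> v x \<Longrightarrow> 0 \<le> v y \<Longrightarrow> 0 \<le> v (x * y)" for x y
    using le_v_mult[of 0 _ 0] by (simp add: zero_extended_def)
  have one: "0 \<le> v 1" by (simp add: zero_extended_def v_nonzero)
  show ?thesis
  proof (rule ringI)
    show "abelian_group (valuation_ring v)"
    proof (rule abelian_groupI)
      show "\<exists>y\<in>carrier (valuation_ring v). y \<oplus>\<^bsub>valuation_ring v\<^esub> x = \<zero>\<^bsub>valuation_ring v\<^esub>"
        if "x \<in> carrier (valuation_ring v)" for x
        using that by (intro bexI[of _ "- x"]) (auto simp: valuation_ring_def ring_of_type_algebra_def)
    qed (auto simp: valuation_ring_def ring_of_type_algebra_def add algebra_simps)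
    show "Group.monoid (valuation_ring v)"
      by (rule monoidI) (auto simp: valuation_ring_def ring_of_type_algebra_def mult one)
  qed (auto simp: valuation_ring_def ring_of_type_algebra_def algebra_simps)
qed

lemma ideal_valuation_ideal: "ideal {x. 0 < v x} (valuation_ring v)"
proof (rule idealI[OF ring_valuation_ring])
  interpret ring "valuation_ring v" by (rule ring_valuation_ring)
  have mult: "0 < v x \<Longrightarrow> 0 \<le> v y \<Longrightarrow> 0 < v (x * y)" for x y
    by (cases "x = 0"; cases "y = 0") (auto simp: v_nonzero val_mult zero_extended_def add_pos_nonneg)
  show "subgroup {x. 0 < v x} (add_monoid (valuation_ring v))"
  proof (rule add.subgroupI)
    show "{x. 0 < v x} \<noteq> {}" by (auto intro!: exI[of _ 0] simp: zero_extended_def)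
    fix a b assume ab: "a \<in> {x. 0 < v x}" "b \<in> {x. 0 < v x}"
    then show "a \<oplus>\<^bsub>valuation_ring v\<^esub> b \<in> {x. 0 < v x}"
      using less_v_add[of 0 a b] by (simp add: valuation_ring_def ring_of_type_algebra_def zero_extended_def)
    have "\<ominus>\<^bsub>valuation_ring v\<^esub> a = - a"
      using ab by (intro minus_equality) (auto simp: valuation_ring_def ring_of_type_algebra_def)
    with ab show "\<ominus>\<^bsub>valuation_ring v\<^esub> a \<in> {x. 0 < v x}" by simp
  qed (auto simp: valuation_ring_def)
  fix a x assume "a \<in> {x. 0 < v x}" "x \<in> carrier (valuation_ring v)"
  then show "x \<otimes>\<^bsub>valuation_ring v\<^esub> a \<in> {x. 0 < v x}" "a \<otimes>\<^bsub>valuation_ring v\<^esub> x \<in> {x. 0 < v x}"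
    using mult by (auto simp: valuation_ring_def ring_of_type_algebra_def mult.commute[of x a])
qed

text \<open>The coset makes sense for every \<open>x\<close>, also outside the valuation ring, so
  the criteria for membership and equality below carry no side conditions.\<close>

definition residue :: "'b \<Rightarrow> 'b set" where
  "residue x = {x. 0 < v x} +>\<^bsub>valuation_ring v\<^esub> x"

lemma mem_residue_iff: "y \<in> residue x \<longleftrightarrow> 0 < v (y - x)"
proof
  assume "0 < v (y - x)"
  then show "y \<in> residue x"
    by (auto simp: residue_def a_r_coset_def r_coset_def valuation_ring_def ring_of_type_algebra_def
        intro!: exI[of _ "y - x"])
qed (auto simp: residue_def a_r_coset_def r_coset_def valuation_ring_def ring_of_type_algebra_def)

lemma residue_eq_iff: "residue x = residue y \<longleftrightarrow> 0 < v (x - y)"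
proof
  assume "residue x = residue y"
  then show "0 < v (x - y)"
    using mem_residue_iff[of x x] mem_residue_iff[of x y] by (simp add: zero_extended_def)
next
  assume *: "0 < v (x - y)"
  have "0 < v (z - x) \<longleftrightarrow> 0 < v (z - y)" for z
    using less_v_add[of 0 "z - x" "x - y"] less_v_diff[of 0 "z - y" "x - y"] *
    by (auto simp: zero_extended_def)
  then show "residue x = residue y" by (auto simp: mem_residue_iff)
qed

lemma residue_eq_zero_iff: "residue x = \<zero>\<^bsub>residue_ring_of v\<^esub> \<longleftrightarrow> 0 < v x"
proof -
  have "\<zero>\<^bsub>residue_ring_of v\<^esub> = residue 0"
    unfolding residue_ring_of_def FactRing_def
    by (simp add: mem_residue_iff set_eq_iff)
  then show ?thesis by (simp add: residue_eq_iff)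
qed

lemma residue_field_eq: "residue_field F v = residue ` {x \<in> F. 0 \<le> v x}"
  by (simp add: residue_field_def residue_def)

text \<open>Reducing the coefficients modulo the maximal ideal gives a polynomial with root
  \<open>residue x\<close>, for which it is enough that the value at x is positive. A coefficient of
  value 0 keeps the reduction from being zero. The set \<open>S\<close> is left open so that the
  fields generated in \<open>has_trdeg\<close> can be inserted.\<close>

lemma algebraic_residue:
  assumes cs: "set cs \<subseteq> {x \<in> F. 0 \<le> v x}" and unit: "\<exists>c\<in>set cs. v c = 0"
    and x: "0 \<le> v x" and root: "0 < v (poly (Poly cs) x)"
    and S: "residue_field F v \<subseteq> S"
  shows "ring.algebraic (residue_ring_of v) S (residue x)"
proof -
  interpret W: ring "valuation_ring v" by (rule ring_valuation_ring)
  interpret I: ideal "{x. 0 < v x}" "valuation_ring v" by (rule ideal_valuation_ideal)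
  interpret h: ring_hom_ring "valuation_ring v" "residue_ring_of v" residue
    unfolding residue_def residue_ring_of_def by (rule I.rcos_ring_hom_ring)
  have W [simp]: "y \<in> carrier (valuation_ring v) \<longleftrightarrow> 0 \<le> v y"
    "y \<otimes>\<^bsub>valuation_ring v\<^esub> z = y * z" "y \<oplus>\<^bsub>valuation_ring v\<^esub> z = y + z" for y z
    by (auto simp: valuation_ring_def ring_of_type_algebra_def)
  \<comment> \<open>Evaluation by Horner's scheme commutes with reduction. Integrality of the value
    is carried along, since \<open>residue\<close> is a homomorphism on the valuation ring only. The
    reversal is needed because polynomials in HOL-Algebra list the leading coefficient
    first.\<close>
  have *: "0 \<le> v (poly (Poly ds) x) \<and>
      h.S.eval (rev (map residue ds)) (residue x) = residue (poly (Poly ds) x)"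
    if "set ds \<subseteq> {x. 0 \<le> v x}" for ds
    using that
  proof (induction ds)
    case Nil
    then show ?case using residue_eq_zero_iff[of 0] by (simp add: zero_extended_def)
  next
    case (Cons d ds)
    have "0 \<le> v (poly (Poly ds) x)" "0 \<le> v d" using Cons by auto
    moreover from this have "0 \<le> v (d + x * poly (Poly ds) x)"
      using x W.add.m_closed[of d "x * poly (Poly ds) x"] W.m_closed[of x "poly (Poly ds) x"] by simp
    moreover have "set (rev (map residue ds)) \<subseteq> carrier (residue_ring_of v)"
      using Cons.prems h.hom_closed by auto
    moreover have "h.S.eval (rev (map residue (d # ds))) (residue x) =
       residue (poly (Poly ds) x) \<otimes>\<^bsub>residue_ring_of v\<^esub> residue x \<oplus>\<^bsub>residue_ring_of v\<^esub> residue d"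
      using Cons x calculation by (simp add: h.S.eval_append_aux h.hom_closed)
    moreover have "\<dots> = residue (poly (Poly ds) x * x + d)"
      using calculation(1,2) x h.hom_mult[of "poly (Poly ds) x" x]
        h.hom_add[of "poly (Poly ds) x * x" d] W.m_closed[of "poly (Poly ds) x" x] by simp
    ultimately show ?case by (simp add: algebra_simps)
  qed
  \<comment> \<open>The top coefficients may have residue 0, so the reduced list must be stripped of
    leading zeros to be a polynomial.\<close>
  define p where "p = h.S.normalize (rev (map residue cs))"
  have car: "set (rev (map residue cs)) \<subseteq> carrier (residue_ring_of v)" "residue x \<in> carrier (residue_ring_of v)"
    using cs x by (auto intro!: h.hom_closed)
  have "h.S.eval p (residue x) = residue (poly (Poly cs) x)"
    unfolding p_def h.S.eval_normalize[OF car] using * cs by blast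
  then have eval: "h.S.eval p (residue x) = \<zero>\<^bsub>residue_ring_of v\<^esub>"
    using root by (simp add: residue_eq_zero_iff)
  have "set (rev (map residue cs)) \<subseteq> S"
    using cs S by (auto simp: residue_field_eq)
  then have "p \<in> carrier (univ_poly (residue_ring_of v) S)"
    unfolding p_def by (simp add: univ_poly_def h.S.normalize_gives_polynomial)
  moreover have "p \<noteq> []"
  proof
    assume "p = []"
    then have "set (rev (map residue cs)) \<subseteq> {\<zero>\<^bsub>residue_ring_of v\<^esub>}"
      using h.S.normalize_def'(1)[of "rev (map residue cs)"] unfolding p_def
      by (metis append_Nil2 drop_all length_greater_0_conv list.size(3) order_refl set_replicate_conv_if subsetI
          diff_zero singletonI empty_iff singletonD)
    with unit show False by (auto simp: residue_eq_zero_iff)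
  qed
  ultimately show ?thesis
    using h.S.algebraicI[of p S "residue x"] eval by (simp add: over_def)
qed

end

section \<open>Dense subfields and values of $X - b$\<close>

text \<open>\<open>H\<close> is the completion. As \<open>'a\<close> is algebraically closed, the
  assumption \<open>algebraic\<close> makes it an algebraic closure of \<open>H\<close>.\<close>

locale valued_completion = krull_valuation v
  for v :: "'a::alg_closed_field poly fract \<Rightarrow> 'g::linordered_ab_group_add extended" +
  fixes K H :: "'a set"
  assumes subfield_K: "is_subfield K"
    and completion: "is_completion K H v"
    and algebraic: "\<And>x. alg_over H x"
begin

lemmas K_simps = subfield_simps[OF subfield_K]

lemma subfield_H: "is_subfield H"
  using completion by (simp add: is_completion_def)

lemmas H_simps = subfield_simps[OF subfield_H]

lemma K_subset_H: "K \<subseteq> H"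
  using completion by (auto simp: is_completion_def dense_in_def)

abbreviation vK :: "'g set" where
  "vK \<equiv> value_group (const_fract ` K) v"

lemma vK_iff: "\<gamma> \<in> vK \<longleftrightarrow> (\<exists>c\<in>K. c \<noteq> 0 \<and> val (const_fract c) = \<gamma>)"
  by (auto simp: value_group_def)

section \<open>Constants compared with elements of K\<close>

lemma approx_const:
  assumes "a \<in> H" "\<gamma> \<in> vK"
  obtains b where "b \<in> K" "Fin \<gamma> < v (const_fract a - const_fract b)"
proof -
  have "\<gamma> \<in> value_group (const_fract ` H) v"
    using assms(2) K_subset_H by (auto simp: value_group_def)
  then show thesis
    using completion assms(1) that by (fastforce simp: is_completion_def dense_in_def)
qed

text \<open>An element of K closer to a than the value of a itself has the same value, so passing to
  the completion does not enlarge the value group.\<close>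

lemma val_H_in_vK:
  assumes "a \<in> H" "a \<noteq> 0"
  shows "val (const_fract a) \<in> vK"
proof -
  have "val (const_fract a) \<in> value_group (const_fract ` H) v"
    using assms by (auto simp: value_group_def)
  then obtain b where b: "b \<in> K" "Fin (val (const_fract a)) < v (const_fract a - const_fract b)"
    using completion assms(1) by (fastforce simp: is_completion_def dense_in_def)
  with v_eq_of_close[OF _ b(2)] assms show ?thesis
    by (auto simp: vK_iff)
qed

text \<open>In an equation $\sum_i p_i x^i = 0$ over $\widehat K$ two of the terms must have the same value.\<close>

lemma val_const_torsion:
  assumes "x \<noteq> 0"
  shows "\<exists>n>0. \<exists>c\<in>K. c \<noteq> 0 \<and> val (const_fract x ^ n) = val (const_fract c)"
proof -
  obtain p where p: "p \<in> polys_over H" "p \<noteq> 0" "poly p x = 0"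
    using algebraic[of x] by (auto simp: alg_over_def)
  have coeff: "coeff p i \<in> H" for i
    using p(1) H_simps(1) by (simp add: mem_polys_over_iff)
  \<comment> \<open>Zero coefficients are left out, because the value of a zero term is no element
    of the group.\<close>
  define I where "I = {i. i \<le> degree p \<and> coeff p i \<noteq> 0}"
  define t where "t i = const_fract (coeff p i) * const_fract x ^ i" for i
  have "sum t I = (\<Sum>i\<le>degree p. t i)"
    by (rule sum.mono_neutral_left) (auto simp: I_def t_def)
  also have "\<dots> = 0"
    using p(3) by (simp add: t_def poly_altdef flip: const_fract_power const_fract_mult const_fract_sum)
  finally have "sum t I = 0" .
  moreover have "degree p \<in> I" "finite I" "\<And>i. i \<in> I \<Longrightarrow> t i \<noteq> 0"
    using p(2) assms by (auto simp: I_def t_def)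
  ultimately have "\<not> inj_on (\<lambda>i. val (t i)) I"
    using sum_nonzero_of_distinct_values[of I t] by blast
  then obtain i j where ij: "i \<in> I" "j \<in> I" "val (t i) = val (t j)" "i < j"
    unfolding inj_on_def by (metis linorder_neqE_nat)
  then have nz: "coeff p i \<noteq> 0" "coeff p j \<noteq> 0" by (auto simp: I_def)
  \<comment> \<open>Terms i < j of equal value show that x^(j - i) has the value of the quotient of
    their coefficients, which lies in \<open>H\<close>.\<close>
  define d where "d = coeff p i / coeff p j"
  have "const_fract x ^ j = const_fract x ^ i * const_fract x ^ (j - i)"
    using ij(4) by (simp flip: power_add)
  then have "val (const_fract x ^ (j - i)) = val (const_fract d)"
    using ij(3) nz assms by (simp add: t_def d_def const_fract_divide val_mult val_divide algebra_simps)
  moreover have "val (const_fract d) \<in> vK"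
    using coeff nz H_simps by (intro val_H_in_vK) (auto simp: d_def)
  ultimately show ?thesis
    using ij(4) by (intro exI[of _ "j - i"]) (auto simp: vK_iff)
qed

text \<open>This describes the convex subgroup of \<open>'g\<close> generated by \<open>vK\<close>.
  Bounding \<gamma> and its negative by the same element of \<open>vK\<close> makes the symmetry
  under negation immediate.\<close>

definition bounded_by_vK :: "'g \<Rightarrow> bool" where
  "bounded_by_vK \<gamma> \<longleftrightarrow> (\<exists>\<delta>\<in>vK. \<gamma> \<le> \<delta> \<and> - \<gamma> \<le> \<delta>)"

lemma vK_add: "\<gamma> \<in> vK \<Longrightarrow> \<delta> \<in> vK \<Longrightarrow> \<gamma> + \<delta> \<in> vK"
  unfolding vK_iff using K_simps(4) by (metis const_fract_eq_0_iff const_fract_mult mult_eq_0_iff val_mult)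

lemma vK_uminus: "\<gamma> \<in> vK \<Longrightarrow> - \<gamma> \<in> vK"
  unfolding vK_iff using K_simps(5)
  by (metis const_fract_eq_0_iff const_fract_inverse inverse_nonzero_iff_nonzero val_inverse)

lemma bounded_vK: "\<gamma> \<in> vK \<Longrightarrow> bounded_by_vK \<gamma>"
  unfolding bounded_by_vK_def using vK_uminus[of \<gamma>]
  by (metis linear neg_le_0_iff_le neg_0_le_iff_le order_trans)

lemma bounded_uminus_iff [simp]: "bounded_by_vK (- \<gamma>) \<longleftrightarrow> bounded_by_vK \<gamma>"
  by (auto simp: bounded_by_vK_def)

lemma bounded_add:
  assumes "bounded_by_vK \<gamma>" "bounded_by_vK \<delta>"
  shows "bounded_by_vK (\<gamma> + \<delta>)"
proof -
  obtain \<gamma>' \<delta>' where "\<gamma>' \<in> vK" "\<gamma> \<le> \<gamma>'" "- \<gamma> \<le> \<gamma>'" "\<delta>' \<in> vK" "\<delta> \<le> \<delta>'" "- \<delta> \<le> \<delta>'"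
    using assms by (auto simp: bounded_by_vK_def)
  then show ?thesis
    using add_mono[of "- \<gamma>" \<gamma>' "- \<delta>" \<delta>'] unfolding bounded_by_vK_def
    by (intro bexI[of _ "\<gamma>' + \<delta>'"]) (auto intro: add_mono vK_add)
qed

lemma bounded_diff: "bounded_by_vK \<gamma> \<Longrightarrow> bounded_by_vK \<delta> \<Longrightarrow> bounded_by_vK (\<gamma> - \<delta>)"
  using bounded_add[of \<gamma> "- \<delta>"] by simp

lemma bounded_between:
  assumes "bounded_by_vK \<alpha>" "bounded_by_vK \<beta>" "\<alpha> \<le> \<gamma>" "\<gamma> \<le> \<beta>"
  shows "bounded_by_vK \<gamma>"
proof -
  obtain \<delta> \<delta>' where "\<delta> \<in> vK" "- \<alpha> \<le> \<delta>" "\<delta>' \<in> vK" "\<beta> \<le> \<delta>'"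
    using assms by (auto simp: bounded_by_vK_def)
  moreover from this have "- \<gamma> \<le> \<delta>" using assms(3) by (metis neg_le_iff_le order_trans)
  ultimately have "max \<delta> \<delta>' \<in> vK" "\<gamma> \<le> max \<delta> \<delta>'" "- \<gamma> \<le> max \<delta> \<delta>'"
    using assms(4) by (auto simp: max_def)
  then show ?thesis by (auto simp: bounded_by_vK_def)
qed

lemma bounded_0: "bounded_by_vK 0"
  by (intro bounded_vK) (auto simp: vK_iff K_simps intro!: bexI[of _ 1])

text \<open>The value of x lies between 0 and that of a power of x, which can be chosen in
  \<open>vK\<close>.\<close>

lemma bounded_const:
  assumes "x \<noteq> 0"
  shows "bounded_by_vK (val (const_fract x))"
proof -
  obtain n where n: "n > 0" "val (const_fract x ^ n) \<in> vK"
    using val_const_torsion[OF assms] by (metis vK_iff)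
  have pow: "(0 \<le> val (const_fract x) \<longrightarrow> val (const_fract x) \<le> val (const_fract x ^ Suc m)) \<and>
        (val (const_fract x) \<le> 0 \<longrightarrow> val (const_fract x ^ Suc m) \<le> val (const_fract x))" for m
  proof (induction m)
    case (Suc m)
    have "val (const_fract x ^ Suc (Suc m)) = val (const_fract x) + val (const_fract x ^ Suc m)"
      using assms by (subst power_Suc) (simp add: val_mult)
    with Suc show ?case by (auto intro: add_increasing add_decreasing)
  qed simp
  obtain m where "n = Suc m" using n(1) gr0_implies_Suc by blast
  with pow[of m] bounded_vK[OF n(2)] bounded_0 show ?thesis
    using bounded_between linear[of 0 "val (const_fract x)"] by metis
qed

text \<open>A polynomial over \<open>H\<close> with root x is scaled to have integral coefficients,
  one of them 1. By density its coefficients are replaced by elements of K with the same residues,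
  so the residue of x is algebraic already over Kv.\<close>

lemma algebraic_residue_const:
  assumes x: "0 \<le> v (const_fract x)"
    and S: "residue_field (const_fract ` K) v \<subseteq> S"
  shows "ring.algebraic (residue_ring_of v) S (residue (const_fract x))"
proof -
  obtain p where p: "p \<in> polys_over H" "p \<noteq> 0" "poly p x = 0"
    using algebraic[of x] by (auto simp: alg_over_def)
  have coeff: "coeff p i \<in> H" for i
    using p(1) H_simps(1) by (simp add: mem_polys_over_iff)
  define I where "I = {i. i \<le> degree p \<and> coeff p i \<noteq> 0}"
  have "degree p \<in> I" using p(2) by (simp add: I_def)
  then have I: "finite I" "I \<noteq> {}" by (auto simp: I_def)
  \<comment> \<open>Divide by a coefficient of least value, so that the residue of the polynomial is defined and nonzero.\<close>
  define m where "m = arg_min_on (\<lambda>i. val (const_fract (coeff p i))) I"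
  have m: "m \<in> I" "\<And>i. i \<in> I \<Longrightarrow> val (const_fract (coeff p m)) \<le> val (const_fract (coeff p i))"
    unfolding m_def using I by (auto intro: arg_min_if_finite arg_min_least)
  define a where "a i = coeff p i / coeff p m" for i
  have a: "a i \<in> H" "0 \<le> v (const_fract (a i))" for i
  proof -
    show "a i \<in> H" using coeff H_simps(6) by (simp add: a_def)
    show "0 \<le> v (const_fract (a i))"
      using m(1) m(2)[of i] by (cases "coeff p i = 0")
        (auto simp: a_def I_def le_degree v_nonzero const_fract_divide val_divide zero_extended_def)
  qed
  have am: "a m = 1" "m < Suc (degree p)" using m(1) by (auto simp: a_def I_def)
  have "0 \<in> vK" by (auto simp: vK_iff K_simps intro!: bexI[of _ 1])
  then have "\<exists>b\<in>K. 0 < v (const_fract (a i) - const_fract b)" for i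
    using approx_const[OF a(1)[of i]] unfolding zero_extended_def by blast
  then obtain b where b: "\<And>i. b i \<in> K" "\<And>i. 0 < v (const_fract (a i) - const_fract (b i))"
    by metis
  define cs where "cs = map (\<lambda>i. const_fract (b i)) [0..<Suc (degree p)]"
  have nonneg: "0 \<le> v (const_fract (b i))" for i
    using le_v_add[of 0 "const_fract (a i)" "- (const_fract (a i) - const_fract (b i))"] a(2)[of i] b(2)[of i]
    by (simp add: zero_extended_def less_imp_le v_minus_commute)
  show ?thesis
  proof (rule algebraic_residue[OF _ _ x _ S])
    show "set cs \<subseteq> {x \<in> const_fract ` K. 0 \<le> v x}"
      using b(1) nonneg by (auto simp: cs_def)
    \<comment> \<open>The m-th coefficient was scaled to 1, so its approximation is a unit.\<close>
    have "v (const_fract (b m)) = 0"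
      using v_eq_of_close[of 1 "const_fract (b m)"] b(2)[of m]
      by (simp add: am zero_extended_def)
    then show "\<exists>c\<in>set cs. v c = 0" using am(2) by (auto simp: cs_def simp del: upt_Suc)
    have "(\<Sum>i\<le>degree p. a i * x ^ i) = 0"
      using p(3) by (simp add: a_def poly_altdef flip: sum_divide_distrib)
    then have "const_fract (\<Sum>i\<le>degree p. a i * x ^ i) = 0" by simp
    \<comment> \<open>Since x is a root of the scaled polynomial, only the approximation errors
      contribute, and all of them have positive value.\<close>
    then have "poly (Poly cs) (const_fract x) =
        - (\<Sum>i\<le>degree p. (const_fract (a i) - const_fract (b i)) * const_fract x ^ i)"
      unfolding cs_def poly_Poly_map_upt lessThan_Suc_atMost
      by (simp add: const_fract_sum const_fract_mult const_fract_power left_diff_distrib sum_subtractf)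
    moreover have "0 < v (y * const_fract x ^ i)" if y: "0 < v y" for y i
    proof (induction i)
      case (Suc i)
      have "0 < v (z * const_fract x)" if "0 < v z" for z
        using that x by (cases "z = 0"; cases "x = 0")
          (auto simp: v_nonzero val_mult zero_extended_def add_pos_nonneg)
      from this[OF Suc] show ?case by (simp add: mult_ac)
    qed (use y in simp)
    ultimately show "0 < v (poly (Poly cs) (const_fract x))"
      using less_v_sum[of "{..degree p}" 0] b(2) by (simp add: zero_extended_def)
  qed
qed

text \<open>Horner's scheme preserves lower bounds. No upper bound is claimed: cancellation can
  raise the value, as in X - b for b close to X.\<close>

lemma poly_lower_bound:
  assumes X: "bounded_by_vK (val X_fract)"
  shows "\<exists>\<delta>. bounded_by_vK \<delta> \<and> Fin \<delta> \<le> v (poly_fract p)"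
proof (induction p)
  case 0
  show ?case using bounded_0 by auto
next
  case (pCons a p)
  then obtain \<delta> where \<delta>: "bounded_by_vK \<delta>" "Fin \<delta> \<le> v (poly_fract p)" by blast
  obtain \<epsilon> where \<epsilon>: "bounded_by_vK \<epsilon>" "Fin \<epsilon> \<le> v (const_fract a)"
    using bounded_0 bounded_const[of a] by (cases "a = 0") (auto simp: v_nonzero)
  have "Fin (val X_fract) \<le> v X_fract" by (simp add: v_nonzero)
  from le_v_mult[OF this \<delta>(2)] have "Fin (min \<epsilon> (val X_fract + \<delta>)) \<le> v (poly_fract (pCons a p))"
    unfolding poly_fract_pCons using \<epsilon>(2)
    by (intro le_v_add) (erule order_trans[rotated], simp)+
  moreover have "bounded_by_vK (min \<epsilon> (val X_fract + \<delta>))"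
    using bounded_add[OF X \<delta>(1)] \<epsilon>(1) by (simp add: min_def)
  ultimately show ?case by blast
qed

section \<open>The case of an unbounded v(X - b)\<close>

context
  fixes b :: 'a
  assumes cofinal: "cofinal_in vK (value_group (rat_funs K) v)"
    and unbounded: "\<not> bounded_by_vK (val (X_fract - const_fract b))"
begin

text \<open>Cofinality yields upper bounds only; the lower bound comes from applying it to the
  inverse.\<close>

lemma bounded_rat_funs_K:
  assumes "y \<in> rat_funs K" "y \<noteq> 0"
  shows "bounded_by_vK (val y)"
proof -
  have upper: "\<exists>\<delta>\<in>vK. val z \<le> \<delta>" if "z \<in> rat_funs K" "z \<noteq> 0" for z
  proof -
    have "val z \<in> value_group (rat_funs K) v" using that by (auto simp: value_group_def)
    with cofinal show ?thesis unfolding cofinal_in_def by blast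
  qed
  have "inverse y \<in> rat_funs K"
    using rat_funs_divide[OF subfield_K rat_funs_1[OF subfield_K] assms(1)] by (simp add: inverse_eq_divide)
  with upper[of "inverse y"] upper[OF assms] assms obtain \<delta> \<delta>' where
    "\<delta> \<in> vK" "val y \<le> \<delta>" "\<delta>' \<in> vK" "- val y \<le> \<delta>'" by (auto simp: val_inverse)
  then show ?thesis
    using bounded_between[of "- \<delta>'" \<delta> "val y"] by (simp add: bounded_vK minus_le_iff[of "val y"])
qed

lemma bounded_X: "bounded_by_vK (val X_fract)"
  by (intro bounded_rat_funs_K X_fract_in_rat_funs subfield_K) simp

text \<open>The difference is (X - b) q with q the synthetic quotient. The value of q is bounded
  from below, while that of X - b exceeds every bounded value.\<close>

lemma less_v_poly_minus_value:
  assumes "bounded_by_vK \<delta>"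
  shows "Fin \<delta> < v (poly_fract p - const_fract (poly p b))"
proof -
  \<comment> \<open>With a bounded lower estimate for v(X - b), unboundedness can only mean that it
    lies above all bounded values.\<close>
  obtain \<epsilon> where \<epsilon>: "bounded_by_vK \<epsilon>" "Fin \<epsilon> \<le> v (X_fract - const_fract b)"
    using poly_lower_bound[OF bounded_X, of "[:- b, 1:]"] by (auto simp: X_fract_minus_const)
  have large: "\<delta> < val (X_fract - const_fract b)" if "bounded_by_vK \<delta>" for \<delta>
  proof (rule ccontr)
    assume "\<not> ?thesis"
    then have "val (X_fract - const_fract b) \<le> \<delta>" by simp
    moreover have "\<epsilon> \<le> val (X_fract - const_fract b)" using \<epsilon>(2) by (simp add: v_nonzero)
    ultimately show False using unbounded bounded_between[OF \<epsilon>(1) that] by blast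
  qed
  obtain \<eta> where \<eta>: "bounded_by_vK \<eta>" "Fin \<eta> \<le> v (poly_fract (synthetic_div p b))"
    using poly_lower_bound[OF bounded_X] by blast
  have "p = synthetic_div p b * [:- b, 1:] + [:poly p b:]"
    using synthetic_div_correct'[of b p] by (metis mult.commute)
  then have "poly_fract p = poly_fract (synthetic_div p b) * (X_fract - const_fract b) + const_fract (poly p b)"
    by (metis X_fract_minus_const const_fract_def poly_fract_add poly_fract_mult)
  then have eq: "poly_fract p - const_fract (poly p b) = poly_fract (synthetic_div p b) * (X_fract - const_fract b)"
    by simp
  have "\<delta> - \<eta> < val (X_fract - const_fract b)"
    using large bounded_diff assms \<eta>(1) by blast
  then have "Fin (\<delta> - val (X_fract - const_fract b)) < Fin \<eta>" by (simp add: algebra_simps)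
  also note \<eta>(2)
  finally show ?thesis unfolding eq by (simp add: less_v_mult_iff)
qed

text \<open>The constant is f(b)/g(b), where y = f/g with f and g over K.\<close>

lemma rat_funs_K_close_to_const:
  assumes "y \<in> rat_funs K" "bounded_by_vK \<delta>"
  shows "\<exists>x. Fin \<delta> < v (y - const_fract x)"
proof -
  obtain f g where fg: "f \<in> polys_over K" "g \<in> polys_over K" "g \<noteq> 0" "y = poly_fract f / poly_fract g"
    using assms by (auto simp: rat_funs_def)
  have bounded: "bounded_by_vK (val (poly_fract h))" if "h \<in> polys_over K" "h \<noteq> 0" for h
    using that by (intro bounded_rat_funs_K poly_fract_in_rat_funs subfield_K) auto
  \<comment> \<open>The value of g is bounded, so g(b) approximates g beyond that value; in
    particular b is no root of g.\<close>
  have g: "poly g b \<noteq> 0" "val (const_fract (poly g b)) = val (poly_fract g)"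
    using v_eq_of_close[OF _ less_v_poly_minus_value[OF bounded[OF fg(2,3)], of g]] fg(3) by auto
  have "Fin \<delta> < v (poly_fract f / poly_fract g - const_fract (poly f b) / const_fract (poly g b))"
    using fg g assms(2)
    by (intro less_v_quotient_diff less_v_poly_minus_value bounded_add bounded_diff bounded) auto
  then show ?thesis unfolding fg(4) const_fract_divide[symmetric] by blast
qed

lemma not_value_transcendental: "\<not> value_transcendental K v"
  unfolding value_transcendental_def
proof (rule torsion_imp_not_rational_rank_1_Mod)
  show "1 \<in> rat_funs K" and "\<And>x y. x \<in> rat_funs K \<Longrightarrow> y \<in> rat_funs K \<Longrightarrow> x / y \<in> rat_funs K"
    by (auto intro: rat_funs_1 rat_funs_divide subfield_K)
  show "1 \<in> const_fract ` K" using K_simps(2) by (auto intro!: image_eqI[of _ _ 1])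
  show "x / y \<in> const_fract ` K" if "x \<in> const_fract ` K" "y \<in> const_fract ` K" for x y
    using that K_simps(6) by (auto simp flip: const_fract_divide)
  show "const_fract ` K \<subseteq> rat_funs K" by (auto intro: const_fract_in_rat_funs subfield_K)
  fix y assume y: "y \<in> rat_funs K" "y \<noteq> 0"
  then obtain x where x: "Fin (val y) < v (y - const_fract x)"
    using rat_funs_K_close_to_const bounded_rat_funs_K by blast
  from v_eq_of_close[OF y(2) x] have nz: "x \<noteq> 0" "val (const_fract x) = val y" by auto
  have "val (y ^ n) = val (const_fract x ^ n)" for n
    by (induction n) (use nz y in \<open>auto simp: val_mult\<close>)
  with val_const_torsion[OF nz(1)] show "\<exists>n>0. \<exists>c\<in>const_fract ` K. c \<noteq> 0 \<and> val (y ^ n) = val c"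
    by (metis const_fract_eq_0_iff imageI)
qed

lemma not_residue_transcendental: "\<not> residue_transcendental K v"
proof
  let ?R = "residue_ring_of v"
  assume "residue_transcendental K v"
  then obtain B where B: "B \<subseteq> residue_field (rat_funs K) v" "card B = 1"
    and trans: "\<forall>b\<in>B. ring.transcendental ?R
      (generate_field ?R (residue_field (const_fract ` K) v \<union> (B - {b}))) b"
    unfolding residue_transcendental_def has_trdeg_def by (elim exE conjE) (rule that)
  obtain r where r: "B = {r}" using B(2) by (rule card_1_singletonE)
  with B(1) obtain y where y: "y \<in> rat_funs K" "0 \<le> v y" "r = residue y"
    by (auto simp: residue_field_eq)
  obtain x where x: "0 < v (y - const_fract x)"
    using rat_funs_K_close_to_const[OF y(1) bounded_0] by (auto simp: zero_extended_def)
  \<comment> \<open>Every residue of K(X) is thus the residue of a constant, hence algebraic over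
    Kv.\<close>
  then have eq: "r = residue (const_fract x)" by (simp add: y residue_eq_iff)
  have "0 \<le> v (const_fract x)"
    using le_v_add[of 0 y "- (y - const_fract x)"] x y(2)
    by (simp add: zero_extended_def less_imp_le v_minus_commute)
  then have "ring.algebraic ?R (generate_field ?R (residue_field (const_fract ` K) v \<union> (B - {r}))) r"
    unfolding eq by (intro algebraic_residue_const) (auto intro: generate_field.incl)
  with trans r show False by blast
qed

end

section \<open>Boundedness of v(X - b) in both cases\<close>

lemma bounded_linear_of_valuation_transcendental:
  assumes "valuation_transcendental K v" "cofinal_in vK (value_group (rat_funs K) v)"
  shows "bounded_by_vK (val (X_fract - const_fract b))"
  using assms not_value_transcendental not_residue_transcendental
  unfolding valuation_transcendental_def by blast

text \<open>Three indices i < j < k suffice, where v(a_j - b) = v(a_i - b). If \<gamma>_j were below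
  v(X - b), these two values would be \<gamma>_j and \<gamma>_i, which differ. So v(X - b) is below
  \<gamma>_k and equals v(a_k - b), the value of a constant.\<close>

lemma bounded_linear_of_type_I:
  assumes "valuation_algebraic_type_I K v"
  shows "bounded_by_vK (val (X_fract - const_fract b))"
proof -
  from assms obtain r :: "'g rel" and \<gamma> :: "'g \<Rightarrow> 'g extended" and a where
    r: "limit_well_order r" and
    mono: "\<forall>i j. (i, j) \<in> r \<and> i \<noteq> j \<longrightarrow> \<gamma> i < \<gamma> j" and
    "cofinal_in (\<gamma> ` Field r) {v (X_fract - const_fract c) | c. alg_over K c}" and
    a: "\<forall>i\<in>Field r. alg_over K (a i) \<and> v (X_fract - const_fract (a i)) = \<gamma> i" and
    trans: "transcendental_type r (range const_fract) v (\<lambda>i. const_fract (a i))"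
    unfolding valuation_algebraic_type_I_def by (elim exE conjE) (rule that)
  have "- const_fract b = const_fract (- b)" using const_fract_diff[of 0 b] by simp
  moreover have "1 = const_fract 1" by simp
  ultimately have "{- const_fract b, 1} \<subseteq> range const_fract" by blast
  then have "[:- const_fract b, 1:] \<in> polys_over (range const_fract)" by (simp add: polys_over_def)
  with trans have "\<exists>i\<in>Field r. \<forall>j. (i, j) \<in> r \<longrightarrow>
      v (poly [:- const_fract b, 1:] (const_fract (a j))) = v (poly [:- const_fract b, 1:] (const_fract (a i)))"
    unfolding transcendental_type_def by blast
  then obtain i where i: "i \<in> Field r"
    and const: "\<And>j. (i, j) \<in> r \<Longrightarrow> v (const_fract (a j) - const_fract b) = v (const_fract (a i) - const_fract b)"
    by auto
  obtain j where j: "(i, j) \<in> r" "i \<noteq> j" using r i unfolding limit_well_order_def by blast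
  then have jF: "j \<in> Field r" by (auto simp: Field_def)
  obtain k where k: "(j, k) \<in> r" "j \<noteq> k" using r jF unfolding limit_well_order_def by blast
  then have kF: "k \<in> Field r" by (auto simp: Field_def)
  have close: "v (const_fract c - const_fract b) = v (X_fract - const_fract c)"
    if "v (X_fract - const_fract c) < v (X_fract - const_fract b)" for c
    using v_eq_of_less[of "const_fract c - X_fract" "const_fract c - const_fract b"] that
      v_minus_commute[of "const_fract c" X_fract] v_minus_commute[of "const_fract b" X_fract] by simp
  have "\<not> v (X_fract - const_fract (a j)) < v (X_fract - const_fract b)"
  proof
    assume *: "v (X_fract - const_fract (a j)) < v (X_fract - const_fract b)"
    moreover have "v (X_fract - const_fract (a i)) < v (X_fract - const_fract (a j))"
      using mono j a i jF by simp
    ultimately show False using close[of "a i"] close[of "a j"] const[OF j(1)] by simp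
  qed
  then have "v (X_fract - const_fract b) < v (X_fract - const_fract (a k))"
    using mono k a jF kF by (metis le_less_trans not_less)
  \<comment> \<open>The difference of X - b and a_k - b is X - a_k.\<close>
  then have *: "Fin (val (X_fract - const_fract b)) < v ((X_fract - const_fract b) - const_fract (a k - b))"
    by (simp add: v_nonzero const_fract_diff)
  from v_eq_of_close[OF _ *] show ?thesis
    using bounded_const[of "a k - b"] by auto
qed

section \<open>From linear factors to polynomials and their approximation\<close>

lemma bounded_val_poly_fract:
  assumes linear: "\<And>b. bounded_by_vK (val (X_fract - const_fract b))" and "p \<noteq> 0"
  shows "bounded_by_vK (val (poly_fract p))"
  using assms(2)
proof (induction "degree p" arbitrary: p)
  case 0
  then obtain c where "p = [:c:]" "c \<noteq> 0" by (metis degree_eq_zeroE pCons_eq_0_iff)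
  then show ?case using bounded_const[of c] by (simp add: const_fract_def)
next
  case (Suc n)
  \<comment> \<open>The field of constants is algebraically closed, so a linear factor splits
    off.\<close>
  then obtain b where "poly p b = 0" using alg_closed_imp_poly_has_root[of p] by auto
  then obtain q where q: "p = [:- b, 1:] * q" by (metis dvdE poly_eq_0_iff_dvd)
  with Suc.prems have nz: "q \<noteq> 0" by auto
  have "degree p = Suc (degree q)"
    unfolding q using nz by (subst degree_mult_eq) (simp_all del: mult_pCons_left)
  then have "bounded_by_vK (val (poly_fract q))" using Suc nz by simp
  then show ?case
    using nz linear[of b] by (simp only: q poly_fract_mult flip: X_fract_minus_const) (simp add: val_mult bounded_add)
qed

text \<open>Coefficients are approximated one at a time, zero by zero and nonzero by nonzero, which
  preserves the degree. The induction varies \<beta> because multiplication by X shifts the required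
  precision by the value of X.\<close>

lemma approx_poly:
  assumes X: "bounded_by_vK (val X_fract)"
    and "f \<in> polys_over H" "bounded_by_vK \<beta>"
  shows "\<exists>f'\<in>polys_over K. (f' = 0 \<longleftrightarrow> f = 0) \<and> degree f' = degree f \<and>
    Fin \<beta> < v (poly_fract f - poly_fract f')"
  using assms(2,3)
proof (induction f arbitrary: \<beta>)
  case 0
  show ?case using K_simps(1) by (intro bexI[of _ 0]) (auto simp: mem_polys_over_iff)
next
  case (pCons a f)
  have a: "a \<in> H" and f: "f \<in> polys_over H"
    using pCons.prems(1) H_simps(1) by (force simp: mem_polys_over_iff coeff_pCons split: nat.splits)+
  obtain f' where f': "f' \<in> polys_over K" "f' = 0 \<longleftrightarrow> f = 0" "degree f' = degree f"
    "Fin (\<beta> - val X_fract) < v (poly_fract f - poly_fract f')"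
    using pCons.IH[OF f bounded_diff[OF pCons.prems(2) X]] by blast
  have "\<exists>a'\<in>K. (a' = 0 \<longleftrightarrow> a = 0) \<and> Fin \<beta> < v (const_fract a - const_fract a')"
  proof (cases "a = 0")
    case True
    then show ?thesis using K_simps(1) by auto
  next
    case False
    obtain \<gamma> where \<gamma>: "\<gamma> \<in> vK" "\<beta> \<le> \<gamma>" using pCons.prems(2) by (auto simp: bounded_by_vK_def)
    \<comment> \<open>Precision at least the value of a forces the approximation to have that value,
      hence to be nonzero.\<close>
    then have "max \<gamma> (val (const_fract a)) \<in> vK"
      using val_H_in_vK[OF a False] by (simp add: max_def)
    from approx_const[OF a this] obtain a' where a': "a' \<in> K"
      "Fin (max \<gamma> (val (const_fract a))) < v (const_fract a - const_fract a')" .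
    have "Fin (val (const_fract a)) \<le> Fin (max \<gamma> (val (const_fract a)))"
      "Fin \<beta> \<le> Fin (max \<gamma> (val (const_fract a)))" using \<gamma>(2) by (auto simp: max_def)
    with a'(2) have "Fin (val (const_fract a)) < v (const_fract a - const_fract a')"
      "Fin \<beta> < v (const_fract a - const_fract a')" by (meson le_less_trans)+
    with v_eq_of_close(1)[of "const_fract a" "const_fract a'"] a'(1) False show ?thesis by auto
  qed
  then obtain a' where a': "a' \<in> K" "a' = 0 \<longleftrightarrow> a = 0"
    "Fin \<beta> < v (const_fract a - const_fract a')" by blast
  have "Fin \<beta> < v ((poly_fract f - poly_fract f') * X_fract)"
    using f'(4) by (simp add: less_v_mult_iff)
  from less_v_add[OF a'(3) this] have
    "Fin \<beta> < v (poly_fract (pCons a f) - poly_fract (pCons a' f'))"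
    by (simp add: poly_fract_pCons algebra_simps)
  moreover have "pCons a' f' \<in> polys_over K"
    using a'(1) f'(1) K_simps(1) by (auto simp: mem_polys_over_iff coeff_pCons split: nat.splits)
  ultimately show ?case using f' a' by (intro bexI[of _ "pCons a' f'"]) auto
qed

lemma approx_fraction:
  assumes linear: "\<And>b. bounded_by_vK (val (X_fract - const_fract b))"
    and \<alpha>: "\<alpha> \<in> value_group (rat_funs H) v"
    and fg: "f \<in> polys_over H" "g \<in> polys_over H" "g \<noteq> 0"
  shows "\<exists>f'\<in>polys_over K. \<exists>g'\<in>polys_over K.
           g' \<noteq> 0 \<and> degree f = degree f' \<and> degree g = degree g' \<and>
           v (poly_fract f) = v (poly_fract f') \<and> v (poly_fract g) = v (poly_fract g') \<and>
           v (poly_fract f - poly_fract f') > Fin \<alpha> \<and>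
           v (poly_fract g - poly_fract g') > Fin \<alpha> \<and>
           v (poly_fract f / poly_fract g - poly_fract f' / poly_fract g') > Fin \<alpha>"
proof -
  note poly_bounded = bounded_val_poly_fract[OF linear]
  have X: "bounded_by_vK (val X_fract)" using linear[of 0] by simp
  \<comment> \<open>\<alpha> is a difference of values of two nonzero polynomials.\<close>
  have \<alpha>: "bounded_by_vK \<alpha>"
    using \<alpha> by (auto simp: value_group_def rat_funs_def val_divide intro!: bounded_diff poly_bounded)
  have approx: "\<exists>h'\<in>polys_over K. degree h = degree h' \<and> (h' = 0 \<longleftrightarrow> h = 0) \<and>
      v (poly_fract h) = v (poly_fract h') \<and> Fin \<alpha> < v (poly_fract h - poly_fract h') \<and>
      Fin \<beta> < v (poly_fract h - poly_fract h')"
    if h: "h \<in> polys_over H" and \<beta>: "bounded_by_vK \<beta>" for h \<beta>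
  proof -
    \<comment> \<open>Besides the two precisions asked for, the value of h itself is included, so
      that h' inherits it.\<close>
    define \<gamma> where "\<gamma> = (if h = 0 then max \<alpha> \<beta> else max (max \<alpha> \<beta>) (val (poly_fract h)))"
    have "bounded_by_vK \<gamma>" using \<alpha> \<beta> poly_bounded[of h] by (auto simp: \<gamma>_def max_def)
    from approx_poly[OF X h this] obtain h' where h': "h' \<in> polys_over K" "h' = 0 \<longleftrightarrow> h = 0"
      "degree h' = degree h" "Fin \<gamma> < v (poly_fract h - poly_fract h')" by blast
    have less: "Fin \<delta> < v (poly_fract h - poly_fract h')" if "\<delta> \<le> \<gamma>" for \<delta>
      using that h'(4) by (meson le_less_trans less_eq_extended.simps(1))
    have "v (poly_fract h) = v (poly_fract h')"
    proof (cases "h = 0")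
      case False
      then have "Fin (val (poly_fract h)) < v (poly_fract h - poly_fract h')"
        by (intro less) (simp add: \<gamma>_def)
      from v_eq_of_close[OF _ this] False show ?thesis by (simp add: v_nonzero)
    qed (use h'(2) in simp)
    moreover have "\<alpha> \<le> \<gamma>" "\<beta> \<le> \<gamma>" by (auto simp: \<gamma>_def max_def)
    ultimately show ?thesis using h' less by (intro bexI[of _ h']) auto
  qed
  have g: "bounded_by_vK (val (poly_fract g))" using fg(3) by (rule poly_bounded)
  obtain f' where f': "f' \<in> polys_over K" "degree f = degree f'"
    "v (poly_fract f) = v (poly_fract f')" "Fin \<alpha> < v (poly_fract f - poly_fract f')"
    "Fin (\<alpha> + val (poly_fract g)) < v (poly_fract f - poly_fract f')"
    using approx[OF fg(1) bounded_add[OF \<alpha> g]] by blast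
  \<comment> \<open>This is the precision for g demanded by \<open>less_v_quotient_diff\<close>. For
    f = 0 nothing is demanded, and 0 serves as a bounded default.\<close>
  define \<beta> where "\<beta> = (if f = 0 then 0 else \<alpha> + val (poly_fract g) + val (poly_fract g) - val (poly_fract f))"
  have "bounded_by_vK \<beta>"
    using \<alpha> g by (auto simp: \<beta>_def bounded_0 intro!: bounded_add bounded_diff poly_bounded)
  from approx[OF fg(2) this] obtain g' where g': "g' \<in> polys_over K" "degree g = degree g'" "g' \<noteq> 0"
    "v (poly_fract g) = v (poly_fract g')" "Fin \<alpha> < v (poly_fract g - poly_fract g')"
    "Fin \<beta> < v (poly_fract g - poly_fract g')" using fg(3) by blast
  have "Fin \<alpha> < v (poly_fract f / poly_fract g - poly_fract f' / poly_fract g')"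
    using fg(3) g' f'(5) by (intro less_v_quotient_diff) (auto simp: \<beta>_def v_nonzero split: if_splits)
  with f' g' show ?thesis by blast
qed

end

theorem theorem1p4:
  fixes K H :: "'a::alg_closed_field set"
    and v :: "'a poly fract \<Rightarrow> 'g::linordered_ab_group_add extended"
    and f g :: "'a poly"
    and \<alpha> :: 'g
  assumes "is_subfield K"
    and "valuation_on UNIV v"
    and "is_completion K H v"
    and "\<forall>x. alg_over H x"
    and "(valuation_transcendental K v \<and>
            cofinal_in (value_group (const_fract ` K) v) (value_group (rat_funs K) v)) \<or>
         valuation_algebraic_type_I K v"
    and "\<alpha> \<in> value_group (rat_funs H) v"
    and "f \<in> polys_over H"
    and "g \<in> polys_over H"
    and "g \<noteq> 0"
  shows "\<exists>f'\<in>polys_over K. \<exists>g'\<in>polys_over K.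
           g' \<noteq> 0 \<and>
           degree f = degree f' \<and> degree g = degree g' \<and>
           v (poly_fract f) = v (poly_fract f') \<and> v (poly_fract g) = v (poly_fract g') \<and>
           v (poly_fract f - poly_fract f') > Fin \<alpha> \<and>
           v (poly_fract g - poly_fract g') > Fin \<alpha> \<and>
           v (poly_fract f / poly_fract g - poly_fract f' / poly_fract g') > Fin \<alpha>"
proof -
  interpret valued_completion v K H
    using assms(1-4) by (intro valued_completion.intro krull_valuation.intro valued_completion_axioms.intro) blast+
  \<comment> \<open>The two alternative assumptions on v enter only through this bound.\<close>
  have "bounded_by_vK (val (X_fract - const_fract b))" for b
    using assms(5) bounded_linear_of_valuation_transcendental bounded_linear_of_type_I by blast
  then show ?thesis using assms(6-9) by (rule approx_fraction)
qed

end
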